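(* Let $\mathbb{K}$ be a field with $|\mathbb{K}|>2$ and let $(X,Z,\Xi,\Theta)$ be a dual split pre-Veronese set. If $p_1,p_2\in X\cup Z$ are non-collinear, then there is a unique member of $\Xi\cup\Theta$ containing both $p_1$ and $p_2$.
   Context: Let $\mathbb{K}$ be a field. For integers $R\ge1$, $V\ge -1$, an $(R,V)$-cone is a cone with a $V$-dimensional vertex (empty if $V=-1$) over a non-degenerate hyperbolic quadric in $\mathbb{P}^{2R+1}(\mathbb{K})$; the $(R,V)$-tube is the cone minus its vertex. Let $r,v,r',v'\ge -1$ be integers with $r'>r\ge1$, $d=2r+v+1$, $d'=2r'+v'+1$. Let $X,Z$ be point sets with $X\cup Z$ spanning $\mathbb{P}^N(\mathbb{K})$, $Y:=\langle Z\rangle$; $\Xi$ a family of $(d+1)$-dimensional subspaces with $|\Xi|>1$, $\Theta$ a possibly empty family of $(d'+1)$-dimensional subspaces such that: for $\xi\in\Xi$, $(X\cup Y)\cap\xi$ is an $(r,v)$-cone with vertex $Y\cap\xi$ and $X\cap\xi$ is its tube; for $\theta\in\Theta$, $(X\cup Y)\cap\theta$ is an $(r',v')$-cone $C_\theta$, $Y\cap\theta$ is a generator $M$ of $C_\theta$, $Z\cap\theta$ is the disjoint union of the vertex $V_\theta$ and an $r'$-space of $M$ complementary to $V_\theta$, and $X\cap\theta=C_\theta\setminus M$. A subspace is singular if all its points lie in $X\cup Y$; two points are collinear if the joining line is singular. Axioms: (S1) any two distinct points of $X\cup Z$ lie in a common member of $\Xi\cup\Theta$; (S2) the intersection of two distinct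 members of $\Xi\cup\Theta$ is singular. A dual split pre-Veronese set (pre-DSV) is such a quadruple satisfying (S1) and (S2). *)

theory Defs
  imports "HOL-Analysis.Analysis"
begin

text \<open>Model of PG(N,K): the underlying vector space is K^n (type 'k^'n, N+1 = CARD('n)).
A projective point is a 1-dimensional linear subspace; a projective subspace of
projective dimension k is a linear subspace of (vector) dimension k+1.
Point sets are sets of projective points.\<close>

definition ppoint :: "('k::field ^ 'n) set \<Rightarrow> bool" where
  "ppoint p \<longleftrightarrow> vec.subspace p \<and> vec.dim p = 1"

text \<open>projective subspace of projective dimension k (k \<ge> -1)\<close>
definition psubspace :: "int \<Rightarrow> ('k::field ^ 'n) set \<Rightarrow> bool" where
  "psubspace k W \<longleftrightarrow> vec.subspace W \<and> int (vec.dim W) = k + 1"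

text \<open>the set of projective points lying in a linear subspace W\<close>
definition pts :: "('k::field ^ 'n) set \<Rightarrow> ('k ^ 'n) set set" where
  "pts W = {p. ppoint p \<and> p \<subseteq> W}"

text \<open>the (linear subspace underlying the) projective span of a point set\<close>
definition pspan :: "('k::field ^ 'n) set set \<Rightarrow> ('k ^ 'n) set" where
  "pspan S = vec.span (\<Union>S)"

text \<open>C (a point set) is an (R,V)-cone in the subspace W with vertex P:
  W has projective dimension 2R+V+2, P is a V-dimensional subspace of W, and there are
  linear functionals f_0..f_{2R+1} whose common zero set in W is P such that C is the set
  of points of W on which x_0 x_1 + x_2 x_3 + ... + x_{2R} x_{2R+1} vanishes, x_i = f_i.
  (The functionals then induce coordinates on W/P, so C is the cone with vertex P over
  the non-degenerate hyperbolic quadric of PG(2R+1,K) in standard form.)\<close>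
definition is_cone :: "int \<Rightarrow> int \<Rightarrow> ('k::field ^ 'n) set \<Rightarrow> ('k ^ 'n) set
     \<Rightarrow> ('k ^ 'n) set set \<Rightarrow> bool" where
  "is_cone R V W P C \<longleftrightarrow>
     psubspace (2*R + V + 2) W \<and> psubspace V P \<and> P \<subseteq> W \<and>
     (\<exists>f :: nat \<Rightarrow> ('k ^ 'n) \<Rightarrow> 'k.
        (\<forall>i. Vector_Spaces.linear (*s) (*) (f i)) \<and>
        P = {x \<in> W. \<forall>i < nat (2*R+2). f i x = 0} \<and>
        C = {p \<in> pts W. \<forall>x \<in> p. (\<Sum>j < nat (R+1). f (2*j) x * f (2*j+1) x) = 0})"

text \<open>a generator of a point set C inside W: a maximal subspace all of whose points lie in C\<close>
definition generator :: "('k::field ^ 'n) set set \<Rightarrow> ('k ^ 'n) set \<Rightarrow> bool" where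
  "generator C M \<longleftrightarrow> vec.subspace M \<and> pts M \<subseteq> C \<and>
     (\<forall>M'. vec.subspace M' \<and> M \<subseteq> M' \<and> pts M' \<subseteq> C \<longrightarrow> M' = M)"

text \<open>The quadruple (X,Z,Xi,Theta) with parameters r,v,r',v' satisfies the standing
  hypotheses (before the axioms S1, S2).\<close>
definition dsv_data ::
  "int \<Rightarrow> int \<Rightarrow> int \<Rightarrow> int \<Rightarrow> ('k::field ^ 'n) set set \<Rightarrow> ('k ^ 'n) set set
     \<Rightarrow> ('k ^ 'n) set set \<Rightarrow> ('k ^ 'n) set set \<Rightarrow> bool" where
  "dsv_data r v r' v' X Z Xi Theta \<longleftrightarrow>
     (let d = 2*r + v + 1; d' = 2*r' + v' + 1; Y = pts (pspan Z) in
      r \<ge> 1 \<and> r' > r \<and> v \<ge> -1 \<and> v' \<ge> -1 \<and>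
      (\<forall>p \<in> X \<union> Z. ppoint p) \<and>
      pspan (X \<union> Z) = UNIV \<and>
      (\<exists>a \<in> Xi. \<exists>b \<in> Xi. a \<noteq> b) \<and>
      (\<forall>\<xi> \<in> Xi. psubspace (d+1) \<xi> \<and>
         (\<exists>P. Y \<inter> pts \<xi> = pts P \<and> is_cone r v \<xi> P ((X \<union> Y) \<inter> pts \<xi>) \<and>
              X \<inter> pts \<xi> = ((X \<union> Y) \<inter> pts \<xi>) - pts P)) \<and>
      (\<forall>\<theta> \<in> Theta. psubspace (d'+1) \<theta> \<and>
         (\<exists>P M S. is_cone r' v' \<theta> P ((X \<union> Y) \<inter> pts \<theta>) \<and>
            generator ((X \<union> Y) \<inter> pts \<theta>) M \<and> Y \<inter> pts \<theta> = pts M \<and>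
            psubspace r' S \<and> S \<subseteq> M \<and> S \<inter> P = {0} \<and> vec.span (S \<union> P) = M \<and>
            Z \<inter> pts \<theta> = pts P \<union> pts S \<and>
            X \<inter> pts \<theta> = ((X \<union> Y) \<inter> pts \<theta>) - pts M)))"

definition singular :: "('k::field ^ 'n) set set \<Rightarrow> ('k ^ 'n) set set \<Rightarrow> ('k ^ 'n) set \<Rightarrow> bool" where
  "singular X Z W \<longleftrightarrow> pts W \<subseteq> X \<union> pts (pspan Z)"

definition collinear_pts :: "('k::field ^ 'n) set set \<Rightarrow> ('k ^ 'n) set set
     \<Rightarrow> ('k ^ 'n) set \<Rightarrow> ('k ^ 'n) set \<Rightarrow> bool" where
  "collinear_pts X Z p q \<longleftrightarrow> singular X Z (vec.span (p \<union> q))"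

definition pre_DSV ::
  "int \<Rightarrow> int \<Rightarrow> int \<Rightarrow> int \<Rightarrow> ('k::field ^ 'n) set set \<Rightarrow> ('k ^ 'n) set set
     \<Rightarrow> ('k ^ 'n) set set \<Rightarrow> ('k ^ 'n) set set \<Rightarrow> bool" where
  "pre_DSV r v r' v' X Z Xi Theta \<longleftrightarrow>
     dsv_data r v r' v' X Z Xi Theta \<and>
     (\<forall>p \<in> X \<union> Z. \<forall>q \<in> X \<union> Z. p \<noteq> q \<longrightarrow> (\<exists>\<zeta> \<in> Xi \<union> Theta. p \<subseteq> \<zeta> \<and> q \<subseteq> \<zeta>)) \<and>
     (\<forall>\<zeta>1 \<in> Xi \<union> Theta. \<forall>\<zeta>2 \<in> Xi \<union> Theta. \<zeta>1 \<noteq> \<zeta>2 \<longrightarrow> singular X Z (\<zeta>1 \<inter> \<zeta>2))"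

end

theory Submission
  imports Defs
begin

text \<open>Existence is axiom (S1), which applies because a point is collinear with itself;
  uniqueness is axiom (S2): two distinct members through \<open>p\<^sub>1\<close> and \<open>p\<^sub>2\<close> would meet in a
  singular subspace containing the line \<open>p\<^sub>1p\<^sub>2\<close>, making the points collinear.\<close>

lemma pts_mono: "W \<subseteq> W' \<Longrightarrow> pts W \<subseteq> pts W'"
  by (auto simp: pts_def)

lemma ppoint_subset_eq: "ppoint p \<Longrightarrow> ppoint q \<Longrightarrow> q \<subseteq> p \<Longrightarrow> q = p"
  by (metis ppoint_def vec.subspace_dim_equal order.refl)

lemma pts_ppoint: "ppoint p \<Longrightarrow> pts p = {p}"
  unfolding pts_def using ppoint_subset_eq by blast

lemma singular_subset: "singular X Z W \<Longrightarrow> W' \<subseteq> W \<Longrightarrow> singular X Z W'"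
  unfolding singular_def using pts_mono by blast

lemma ppoint_in_pts_pspan: "ppoint p \<Longrightarrow> p \<in> Z \<Longrightarrow> p \<in> pts (pspan Z)"
  unfolding pts_def pspan_def by (auto intro: vec.span_base)

lemma collinear_pts_refl:
  assumes "ppoint p" and "p \<in> X \<union> Z"
  shows "collinear_pts X Z p p"
proof -
  have span: "vec.span (p \<union> p) = p"
    using assms(1) by (simp add: ppoint_def vec.span_eq_iff)
  have "p \<in> X \<union> pts (pspan Z)"
    using assms ppoint_in_pts_pspan by blast
  then show ?thesis
    unfolding collinear_pts_def singular_def span pts_ppoint[OF assms(1)] by blast
qed

lemma collinear_pts_if_in_singular_subspace:
  assumes "vec.subspace W" and "singular X Z W" and "p \<subseteq> W" and "q \<subseteq> W"
  shows "collinear_pts X Z p q"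
  unfolding collinear_pts_def
  using assms by (intro singular_subset[OF assms(2)] vec.span_minimal) auto

lemma dsv_data_ppoint: "dsv_data r v r' v' X Z Xi Theta \<Longrightarrow> p \<in> X \<union> Z \<Longrightarrow> ppoint p"
  by (simp add: dsv_data_def Let_def)

lemma dsv_data_subspace:
  "dsv_data r v r' v' X Z Xi Theta \<Longrightarrow> \<zeta> \<in> Xi \<union> Theta \<Longrightarrow> vec.subspace \<zeta>"
  by (auto simp: dsv_data_def Let_def psubspace_def)

theorem lemma4p2:
  fixes X Z Xi Theta :: "('k::field ^ 'n) set set" and r v r' v' :: int
  assumes "\<exists>a b c :: 'k. a \<noteq> b \<and> a \<noteq> c \<and> b \<noteq> c"
    and "pre_DSV r v r' v' X Z Xi Theta"
    and "p1 \<in> X \<union> Z" and "p2 \<in> X \<union> Z"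
    and "\<not> collinear_pts X Z p1 p2"
  shows "\<exists>!\<zeta>. \<zeta> \<in> Xi \<union> Theta \<and> p1 \<subseteq> \<zeta> \<and> p2 \<subseteq> \<zeta>"
proof -
  have data: "dsv_data r v r' v' X Z Xi Theta"
    and S1: "\<forall>p \<in> X \<union> Z. \<forall>q \<in> X \<union> Z. p \<noteq> q \<longrightarrow> (\<exists>\<zeta> \<in> Xi \<union> Theta. p \<subseteq> \<zeta> \<and> q \<subseteq> \<zeta>)"
    and S2: "\<forall>\<zeta>1 \<in> Xi \<union> Theta. \<forall>\<zeta>2 \<in> Xi \<union> Theta. \<zeta>1 \<noteq> \<zeta>2 \<longrightarrow> singular X Z (\<zeta>1 \<inter> \<zeta>2)"
    using assms(2) by (simp_all add: pre_DSV_def)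
  have "p1 \<noteq> p2"
    using assms(3,5) collinear_pts_refl dsv_data_ppoint[OF data] by blast
  then obtain \<zeta> where \<zeta>: "\<zeta> \<in> Xi \<union> Theta" "p1 \<subseteq> \<zeta>" "p2 \<subseteq> \<zeta>"
    using S1 assms(3,4) by blast
  moreover have "\<zeta>' = \<zeta>" if \<zeta>': "\<zeta>' \<in> Xi \<union> Theta" "p1 \<subseteq> \<zeta>'" "p2 \<subseteq> \<zeta>'" for \<zeta>'
  proof (rule ccontr)
    assume "\<zeta>' \<noteq> \<zeta>"
    then have "singular X Z (\<zeta>' \<inter> \<zeta>)"
      using S2 \<zeta> \<zeta>' by blast
    moreover have "vec.subspace (\<zeta>' \<inter> \<zeta>)"
      using dsv_data_subspace[OF data] \<zeta> \<zeta>' by (simp add: vec.subspace_inter)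
    ultimately show False
      using assms(5) collinear_pts_if_in_singular_subspace \<zeta> \<zeta>' by (metis le_inf_iff)
  qed
  ultimately show ?thesis by blast
qed

end
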